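(* Let $G$ be a graph with a hole cover $\mathcal C$ satisfying the NC property in $G$. Then every clique of $\widehat G(\mathcal C)$ is a minor of $G$; that is, if $\widehat G(\mathcal C)$ contains a clique on $n$ vertices then $G$ has a $K_n$ minor. In particular, if $G$ is $K_n$-minor-free then $\widehat G(\mathcal C)$ is $K_n$-free.
   Context: All graphs are finite and simple. A hole of $G$ is an induced cycle of length at least $4$; $\mathcal H(G)$ is the set of holes of $G$ and $\mathcal H(G,u)$ the set of holes containing $u$. A hole cover of $G$ is a nonempty $X\subseteq V(G)$ meeting every hole. A vertex $u$ satisfies the NC property in $G$ if there are no holes $H\in\mathcal H(G,u)$, $H'\in\mathcal H(G)\setminus\mathcal H(G,u)$ sharing two consecutive edges (two distinct edges with a common end vertex lying on both). A set $\mathcal C$ satisfies the NC property in $G$ if each of its vertices does and every hole contains at most one vertex of $\mathcal C$. Locally chordalizing all holes in $\mathcal H(G,u)$ by $u$ means adding all edges $uw$ with $w\ne u$ lying on some hole in $\mathcal H(G,u)$. For a hole cover $\mathcal C=\{u_1,\dots,u_k\}$ satisfying the NC property in $G$, set $G_0=G$, let $G_i$ be obtained from $G_{i-1}$ by locally chordalizing all holes in $\mathcal H(G_{i-1},u_i)$ by $u_i$, and put $\widehat G(\mathcal C)=G_k$ (this graph is chordal and independent of the ordering of $\mathcal C$). *)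

theory Defs
  imports Main
begin

text \<open>A finite simple graph is given by a vertex set V and a set E of 2-element edges.\<close>

definition simple_graph :: "'a set \<Rightarrow> 'a set set \<Rightarrow> bool" where
  "simple_graph V E \<longleftrightarrow> finite V \<and>
     (\<forall>e\<in>E. \<exists>u v. e = {u, v} \<and> u \<noteq> v \<and> u \<in> V \<and> v \<in> V)"

definition adj :: "'a set set \<Rightarrow> 'a \<Rightarrow> 'a \<Rightarrow> bool" where
  "adj E u v \<longleftrightarrow> u \<noteq> v \<and> {u, v} \<in> E"

text \<open>A hole: vertex set of an induced cycle of length at least 4 (the induced cycle is
  determined by its vertex set).\<close>
definition is_hole :: "'a set \<Rightarrow> 'a set set \<Rightarrow> 'a set \<Rightarrow> bool" where
  "is_hole V E H \<longleftrightarrow> H \<subseteq> V \<and>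
     (\<exists>vs. distinct vs \<and> set vs = H \<and> length vs \<ge> 4 \<and>
        (\<forall>i<length vs. \<forall>j<length vs.
           adj E (vs ! i) (vs ! j) \<longleftrightarrow>
             (j = Suc i mod length vs \<or> i = Suc j mod length vs)))"

definition hole_cover :: "'a set \<Rightarrow> 'a set set \<Rightarrow> 'a set \<Rightarrow> bool" where
  "hole_cover V E X \<longleftrightarrow> X \<noteq> {} \<and> X \<subseteq> V \<and> (\<forall>H. is_hole V E H \<longrightarrow> H \<inter> X \<noteq> {})"

text \<open>Two holes share two consecutive edges: distinct edges xy, yz lying on both holes
  (edges of a hole = edges of G with both ends on it, since holes are induced).\<close>
definition share_two_consecutive_edges :: "'a set set \<Rightarrow> 'a set \<Rightarrow> 'a set \<Rightarrow> bool" where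
  "share_two_consecutive_edges E H H' \<longleftrightarrow>
     (\<exists>x y z. x \<noteq> z \<and> adj E x y \<and> adj E y z \<and> {x, y, z} \<subseteq> H \<and> {x, y, z} \<subseteq> H')"

definition NC_vertex :: "'a set \<Rightarrow> 'a set set \<Rightarrow> 'a \<Rightarrow> bool" where
  "NC_vertex V E u \<longleftrightarrow>
     \<not> (\<exists>H H'. is_hole V E H \<and> u \<in> H \<and> is_hole V E H' \<and> u \<notin> H' \<and>
              share_two_consecutive_edges E H H')"

definition NC_set :: "'a set \<Rightarrow> 'a set set \<Rightarrow> 'a set \<Rightarrow> bool" where
  "NC_set V E C \<longleftrightarrow> (\<forall>u\<in>C. NC_vertex V E u) \<and>
     (\<forall>H. is_hole V E H \<longrightarrow> card (H \<inter> C) \<le> 1)"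

text \<open>Locally chordalizing all holes containing u by u.\<close>
definition local_chordalize :: "'a set \<Rightarrow> 'a set set \<Rightarrow> 'a \<Rightarrow> 'a set set" where
  "local_chordalize V E u =
     E \<union> {{u, w} | w. w \<noteq> u \<and> (\<exists>H. is_hole V E H \<and> u \<in> H \<and> w \<in> H)}"

text \<open>Edge set of \<open>G_k\<close> for the ordering us = [u_1,...,u_k] of the cover.\<close>
definition chordalize_seq :: "'a set \<Rightarrow> 'a set set \<Rightarrow> 'a list \<Rightarrow> 'a set set" where
  "chordalize_seq V E us = foldl (local_chordalize V) E us"

definition is_clique :: "'a set set \<Rightarrow> 'a set \<Rightarrow> bool" where
  "is_clique E K \<longleftrightarrow> (\<forall>x\<in>K. \<forall>y\<in>K. x \<noteq> y \<longrightarrow> adj E x y)"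

definition connected_in :: "'a set set \<Rightarrow> 'a set \<Rightarrow> bool" where
  "connected_in E S \<longleftrightarrow>
     (\<forall>x\<in>S. \<forall>y\<in>S. (x, y) \<in> {(a, b). a \<in> S \<and> b \<in> S \<and> adj E a b}\<^sup>*)"

text \<open>G has a K_n minor: n pairwise disjoint nonempty connected branch sets,
  pairwise joined by an edge.\<close>
definition has_clique_minor :: "'a set \<Rightarrow> 'a set set \<Rightarrow> nat \<Rightarrow> bool" where
  "has_clique_minor V E n \<longleftrightarrow>
     (\<exists>B :: nat \<Rightarrow> 'a set.
        (\<forall>i<n. B i \<noteq> {} \<and> B i \<subseteq> V \<and> connected_in E (B i)) \<and>
        (\<forall>i<n. \<forall>j<n. i \<noteq> j \<longrightarrow> B i \<inter> B j = {} \<and> (\<exists>x\<in>B i. \<exists>y\<in>B j. adj E x y)))"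

end

theory Submission
  imports Defs
begin

text \<open>If \<open>u\<close> has the NC property, chordalizing at \<open>u\<close> destroys the holes through \<open>u\<close> and creates
  none; hence the final graph arises from \<open>G\<close> by joining each \<open>u \<in> C\<close> to all vertices on holes of
  \<open>G\<close> through \<open>u\<close>. Let \<open>K\<close> be a clique of it. Every edge of \<open>K\<close> missing in \<open>G\<close> joins some
  \<open>u \<in> C\<close> to some \<open>w \<notin> C\<close>. Two vertices \<open>u, u' \<in> K \<inter> C\<close> cannot miss the same \<open>w\<close> (a hole through
  both would arise), and they cannot miss different \<open>w, w'\<close>, as \<open>u u' w w'\<close> would be a hole
  through both. So all missing edges are at a single \<open>u\<close>. For each missing \<open>uw\<close>, a hole through \<open>u\<close>
  and \<open>w\<close> has an arm from \<open>u\<close> to \<open>w\<close> whose interior avoids \<open>K\<close>; adding these interiors to \<open>{u}\<close>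
  gives its branch set, and all other branch sets are singletons.\<close>

subsection \<open>Connected sets and induced paths\<close>

lemma adj_commute: "adj E x y \<longleftrightarrow> adj E y x"
  by (auto simp: adj_def insert_commute)

lemma not_adj_self [simp]: "\<not> adj E x x"
  by (simp add: adj_def)

text \<open>Equality is allowed so that overlapping sets and adjacent sets are glued by one and the
  same rule. The negation says that the sets are disjoint with no edge between them.\<close>

definition touch :: "'a set set \<Rightarrow> 'a set \<Rightarrow> 'a set \<Rightarrow> bool" where
  "touch E S T \<longleftrightarrow> (\<exists>s\<in>S. \<exists>t\<in>T. s = t \<or> adj E s t)"

lemma touchI: "s \<in> S \<Longrightarrow> t \<in> T \<Longrightarrow> s = t \<or> adj E s t \<Longrightarrow> touch E S T"
  by (auto simp: touch_def)

lemma touch_mono: "touch E S T \<Longrightarrow> S \<subseteq> S' \<Longrightarrow> T \<subseteq> T' \<Longrightarrow> touch E S' T'"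
  unfolding touch_def by blast

lemma touch_commute: "touch E S T \<longleftrightarrow> touch E T S"
  unfolding touch_def by (metis adj_commute)

lemma connected_in_singleton [simp]: "connected_in E {x}"
  by (simp add: connected_in_def)

lemma connected_in_Un:
  assumes S: "connected_in E S" and T: "connected_in E T" and "touch E S T"
  shows "connected_in E (S \<union> T)"
proof -
  let ?R = "\<lambda>S. {(a, b). a \<in> S \<and> b \<in> S \<and> adj E a b}"
  obtain s t where st: "s \<in> S" "t \<in> T" "s = t \<or> adj E s t"
    using assms(3) by (auto simp: touch_def)
  have mono: "(?R S)\<^sup>* \<subseteq> (?R (S \<union> T))\<^sup>*" "(?R T)\<^sup>* \<subseteq> (?R (S \<union> T))\<^sup>*"
    by (auto intro!: rtrancl_mono)
  have inS: "(x, y) \<in> (?R (S \<union> T))\<^sup>*" if "x \<in> S" "y \<in> S" for x y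
    using S that mono(1) unfolding connected_in_def by blast
  have inT: "(x, y) \<in> (?R (S \<union> T))\<^sup>*" if "x \<in> T" "y \<in> T" for x y
    using T that mono(2) unfolding connected_in_def by blast
  have step: "(s, t) \<in> (?R (S \<union> T))\<^sup>*" "(t, s) \<in> (?R (S \<union> T))\<^sup>*"
    using st by (auto simp: adj_commute[of E t s])
  show ?thesis
    unfolding connected_in_def
    using inS inT step st(1,2) by (metis (no_types, lifting) Un_iff rtrancl_trans)
qed

text \<open>A walk inside \<open>S\<close> from \<open>x\<close> to \<open>y\<close> can leave
  \<open>X\<close> only by a step into \<open>Y\<close>; without contact between \<open>X\<close>
  and \<open>Y\<close> it would stay in \<open>X\<close> up to its end, which lies in
  \<open>Y\<close>.\<close>

lemma connected_in_touch:
  assumes S: "connected_in E S" and "S \<subseteq> X \<union> Y" "x \<in> S" "x \<in> X" "y \<in> S" "y \<in> Y"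
  shows "touch E X Y"
proof (rule ccontr)
  assume no: "\<not> touch E X Y"
  have "(x, y) \<in> {(a, b). a \<in> S \<and> b \<in> S \<and> adj E a b}\<^sup>*"
    using S assms(3,5) by (simp add: connected_in_def)
  then have "y \<in> X"
  proof (induction rule: rtrancl_induct)
    case base
    then show ?case using assms by simp
  next
    case (step y z)
    then show ?case using no assms(2) unfolding touch_def by blast
  qed
  then show False using no assms(6) by (auto simp: touch_def)
qed

definition induced_path :: "'a set set \<Rightarrow> 'a list \<Rightarrow> bool" where
  "induced_path E ps \<longleftrightarrow> distinct ps \<and>
     (\<forall>i<length ps. \<forall>j<length ps. adj E (ps ! i) (ps ! j) \<longleftrightarrow> j = Suc i \<or> i = Suc j)"

lemma induced_path_take: "induced_path E ps \<Longrightarrow> induced_path E (take n ps)"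
  by (auto simp: induced_path_def)

lemma induced_path_snoc:
  assumes "induced_path E ps" "ps \<noteq> []" "z \<notin> set ps"
    and z: "\<And>i. i < length ps \<Longrightarrow> adj E (ps ! i) z \<longleftrightarrow> Suc i = length ps"
  shows "induced_path E (ps @ [z])"
  using assms(1-3) z unfolding induced_path_def
  by (auto simp: nth_append less_Suc_eq adj_commute[of E z])

lemma connected_in_set_path:
  assumes "\<And>i. Suc i < length ps \<Longrightarrow> adj E (ps ! i) (ps ! Suc i)"
  shows "connected_in E (set ps)"
  using assms
proof (induction ps)
  case Nil
  then show ?case by (simp add: connected_in_def)
next
  case (Cons x ps)
  show ?case
  proof (cases ps)
    case Nil
    then show ?thesis by simp
  next
    case (Cons y qs)
    have "connected_in E (set ps)"
      using Cons.IH Cons.prems[of "Suc _"] by simp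
    moreover have "touch E {x} (set ps)"
      using Cons.prems[of 0] Cons by (auto simp: touch_def)
    ultimately show ?thesis
      using connected_in_Un[of E "{x}" "set ps"] by simp
  qed
qed

lemma induced_path_connected:
  assumes "induced_path E ps"
  shows "connected_in E (set ps)"
  by (rule connected_in_set_path) (use assms in \<open>simp add: induced_path_def\<close>)

text \<open>Induction along a walk: the path is kept induced at every step by shortcutting it when a
  new vertex arrives, so no shortest path has to be chosen.\<close>

lemma connected_in_induced_path:
  assumes "connected_in E S" "p \<in> S" "q \<in> S"
  obtains ps where "induced_path E ps" "ps \<noteq> []" "hd ps = p" "last ps = q" "set ps \<subseteq> S"
proof -
  have "(p, q) \<in> {(a, b). a \<in> S \<and> b \<in> S \<and> adj E a b}\<^sup>*"
    using assms by (simp add: connected_in_def)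
  then have "\<exists>ps. induced_path E ps \<and> ps \<noteq> [] \<and> hd ps = p \<and> last ps = q \<and> set ps \<subseteq> S"
  proof (induction rule: rtrancl_induct)
    case base
    then show ?case
      using assms(2) by (intro exI[of _ "[p]"]) (simp add: induced_path_def)
  next
    case (step y z)
    then obtain ps where ps: "induced_path E ps" "ps \<noteq> []" "hd ps = p" "last ps = y"
        "set ps \<subseteq> S" by blast
    have yz: "adj E y z" "z \<in> S" using step by auto
    \<comment> \<open>Cut the path at the first vertex equal or adjacent to the new endpoint.\<close>
    let ?Q = "\<lambda>i. i < length ps \<and> (ps ! i = z \<or> adj E (ps ! i) z)"
    define i where "i = (LEAST i. ?Q i)"
    have "?Q (length ps - 1)"
      using ps yz by (simp add: last_conv_nth)
    then have i: "?Q i" unfolding i_def by (rule LeastI)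
    have least: "\<not> ?Q j" if "j < i" for j
      using that not_less_Least unfolding i_def by blast
    define qs where "qs = take (Suc i) ps"
    have "last qs = ps ! i"
      using i by (simp add: qs_def take_Suc_conv_app_nth)
    moreover have "set qs \<subseteq> S"
      using ps(5) set_take_subset[of "Suc i" ps] by (auto simp: qs_def)
    ultimately have qs: "induced_path E qs" "qs \<noteq> []" "hd qs = p" "set qs \<subseteq> S"
        "length qs = Suc i" "last qs = ps ! i"
      using ps i by (auto simp: qs_def induced_path_take hd_take)
    show ?case
    proof (cases "ps ! i = z")
      case True
      then show ?thesis using qs by blast
    next
      case False
      have "z \<notin> set qs"
      proof
        assume "z \<in> set qs"
        then obtain j where "j < Suc i" "ps ! j = z"
          using qs(5) by (auto simp: in_set_conv_nth qs_def)
        then show False using False least[of j] i by (cases "j = i") auto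
      qed
      moreover have "adj E (qs ! j) z \<longleftrightarrow> Suc j = length qs" if "j < length qs" for j
        using that qs(5) i least[of j] False by (cases "j = i") (auto simp: qs_def)
      ultimately have "induced_path E (qs @ [z])"
        using qs by (intro induced_path_snoc) auto
      then show ?thesis
        using qs yz by (intro exI[of _ "qs @ [z]"]) auto
    qed
  qed
  then show ?thesis using that by blast
qed

subsection \<open>Holes\<close>

lemma is_hole_pathI:
  assumes "insert u (set ps) \<subseteq> V" "u \<notin> set ps" "induced_path E ps" "length ps \<ge> 3"
    and u: "\<And>i. i < length ps \<Longrightarrow> adj E u (ps ! i) \<longleftrightarrow> i = 0 \<or> Suc i = length ps"
  shows "is_hole V E (insert u (set ps))"
proof -
  have ip: "distinct ps"
    "\<And>i j. i < length ps \<Longrightarrow> j < length ps \<Longrightarrow>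
       adj E (ps ! i) (ps ! j) \<longleftrightarrow> j = Suc i \<or> i = Suc j"
    using assms(3) by (auto simp: induced_path_def)
  have "adj E ((u # ps) ! i) ((u # ps) ! j) \<longleftrightarrow>
      (j = Suc i mod length (u # ps) \<or> i = Suc j mod length (u # ps))"
    if "i < length (u # ps)" "j < length (u # ps)" for i j
    using that assms(4) ip(2) u
    by (cases i; cases j) (auto simp: mod_Suc adj_commute[of E _ u])
  then show ?thesis
    unfolding is_hole_def using assms(1,2,4) ip(1)
    by (intro conjI exI[of _ "u # ps"]) auto
qed

text \<open>Rotating the cyclic list so that \<open>u\<close> comes first removes the modular
  indices: the hole becomes an apex \<open>u\<close> over an induced path of which \<open>u\<close>
  sees the two ends only.\<close>

lemma is_hole_pathE:
  assumes "is_hole V E H" "u \<in> H"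
  obtains ps where "H = insert u (set ps)" "u \<notin> set ps" "induced_path E ps" "length ps \<ge> 3"
    "\<And>i. i < length ps \<Longrightarrow> adj E u (ps ! i) \<longleftrightarrow> i = 0 \<or> Suc i = length ps"
proof -
  obtain vs where vs: "distinct vs" "set vs = H" "length vs \<ge> 4"
    and ad: "\<And>i j. i < length vs \<Longrightarrow> j < length vs \<Longrightarrow>
       adj E (vs ! i) (vs ! j) \<longleftrightarrow> j = Suc i mod length vs \<or> i = Suc j mod length vs"
    using assms(1) unfolding is_hole_def by blast
  define n where "n = length vs"
  obtain k where k: "k < n" "vs ! k = u"
    using assms(2) vs(2) by (auto simp: in_set_conv_nth n_def)
  define ws where "ws = rotate k vs"
  have n: "length ws = n" "n \<ge> 4" using vs by (simp_all add: ws_def n_def)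
  have ws_nth: "ws ! i = vs ! ((k + i) mod n)" if "i < n" for i
    using that by (simp add: ws_def nth_rotate n_def)
  \<comment> \<open>Rotation preserves cyclic succession. That adding \<open>k\<close> modulo
    \<open>n\<close> is injective is read off from the distinctness of \<open>ws\<close>.\<close>
  have shift: "(k + j) mod n = Suc ((k + i) mod n) mod n \<longleftrightarrow> j = Suc i mod n"
    if "i < n" "j < n" for i j
  proof -
    have "Suc ((k + i) mod n) mod n = (k + Suc i mod n) mod n"
      by (metis add_Suc_right mod_Suc_eq mod_add_right_eq)
    moreover have "(k + j) mod n = (k + j') mod n \<longleftrightarrow> j = j'" if "j < n" "j' < n" for j j'
    proof -
      have "ws ! j = ws ! j' \<longleftrightarrow> j = j'"
        using vs(1) that n by (simp add: nth_eq_iff_index_eq ws_def)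
      moreover have "(k + j) mod n < n" "(k + j') mod n < n" using n by auto
      ultimately show ?thesis
        using that ws_nth vs(1) by (metis)
    qed
    ultimately show ?thesis
      using that n by simp
  qed
  have wad: "adj E (ws ! i) (ws ! j) \<longleftrightarrow> j = Suc i mod n \<or> i = Suc j mod n"
    if "i < n" "j < n" for i j
  proof -
    have "(k + i) mod n < n" "(k + j) mod n < n" using n by auto
    then show ?thesis
      using ad[of "(k + i) mod n" "(k + j) mod n"] shift[OF that] shift[OF that(2,1)]
        ws_nth[OF that(1)] ws_nth[OF that(2)] by (simp add: n_def)
  qed
  have w0: "ws ! 0 = u" using ws_nth[of 0] n k by simp
  obtain v ps where "ws = v # ps" using n by (cases ws) auto
  with w0 have ws: "ws = u # ps" by simp
  have dist: "distinct ws" "set ws = H" using vs by (simp_all add: ws_def)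
  have len: "n = Suc (length ps)" using n ws by simp
  have md: "Suc i mod n = (if Suc i = n then 0 else Suc i)" if "i < n" for i
    using that by (cases "Suc i = n") auto
  show ?thesis
  proof
    show "H = insert u (set ps)" "u \<notin> set ps" using dist ws by auto
    show "length ps \<ge> 3" using len n by simp
    show "induced_path E ps"
      unfolding induced_path_def
    proof (intro conjI allI impI)
      show "distinct ps" using dist ws by simp
      show "adj E (ps ! i) (ps ! j) \<longleftrightarrow> j = Suc i \<or> i = Suc j"
        if "i < length ps" "j < length ps" for i j
      proof -
        have "Suc i < n" "Suc j < n" using that len by auto
        then show ?thesis
          using wad[of "Suc i" "Suc j"] md[of "Suc i"] md[of "Suc j"] that
          by (auto simp: ws split: if_splits)
      qed
    qed
    show "adj E u (ps ! i) \<longleftrightarrow> i = 0 \<or> Suc i = length ps" if "i < length ps" for i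
    proof -
      have "0 < n" "Suc i < n" using that len by auto
      then show ?thesis
        using wad[of 0 "Suc i"] md[of 0] md[of "Suc i"] len n(2)
        by (auto simp: ws split: if_splits)
    qed
  qed
qed

text \<open>The main source of holes. An induced path inside \<open>S\<close> from \<open>p\<close>
  to \<open>q\<close> has at least three vertices because its ends are distinct and nonadjacent, and
  \<open>x\<close> sees precisely these ends, hence closes it to a hole.\<close>

lemma hole_at_vertex:
  assumes "x \<in> V" "S \<subseteq> V" "x \<notin> S" "connected_in E S" "p \<in> S" "q \<in> S" "p \<noteq> q" "\<not> adj E p q"
    and x: "\<And>s. s \<in> S \<Longrightarrow> adj E x s \<longleftrightarrow> s = p \<or> s = q"
  shows "\<exists>H. is_hole V E H \<and> x \<in> H \<and> p \<in> H \<and> q \<in> H \<and> H \<subseteq> insert x S"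
proof -
  obtain ps where ps: "induced_path E ps" "ps \<noteq> []" "hd ps = p" "last ps = q" "set ps \<subseteq> S"
    using connected_in_induced_path assms(4-6) by metis
  have p0: "ps ! 0 = p" and ql: "ps ! (length ps - 1) = q"
    using ps by (simp_all add: hd_conv_nth last_conv_nth)
  have "length ps \<noteq> 1" using p0 ql assms(7) by auto
  moreover have "length ps \<noteq> 2"
  proof
    assume "length ps = 2"
    then have "adj E (ps ! 0) (ps ! 1)" using ps(1) by (simp add: induced_path_def)
    then show False using p0 ql assms(8) \<open>length ps = 2\<close> by simp
  qed
  moreover have "length ps \<noteq> 0" using ps by simp
  ultimately have len: "length ps \<ge> 3" by linarith
  have "is_hole V E (insert x (set ps))"
  proof (rule is_hole_pathI)
    show "adj E x (ps ! i) \<longleftrightarrow> i = 0 \<or> Suc i = length ps" if "i < length ps" for i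
    proof -
      have d: "distinct ps" using ps(1) by (simp add: induced_path_def)
      have "adj E x (ps ! i) \<longleftrightarrow> ps ! i = ps ! 0 \<or> ps ! i = ps ! (length ps - 1)"
        using x[OF subsetD[OF ps(5) nth_mem[OF that]]] p0 ql by simp
      moreover have "ps ! i = ps ! 0 \<longleftrightarrow> i = 0"
        "ps ! i = ps ! (length ps - 1) \<longleftrightarrow> i = length ps - 1"
        using that len by (auto intro!: nth_eq_iff_index_eq[OF d])
      ultimately show ?thesis using that by auto
    qed
  qed (use ps assms len in auto)
  moreover have "p \<in> set ps" "q \<in> set ps" using ps by auto
  ultimately show ?thesis using ps(5) by (intro exI[of _ "insert x (set ps)"]) auto
qed

text \<open>\<open>A\<close> and \<open>B\<close> are the two open arcs of the hole between \<open>u\<close> and \<open>x\<close>, with end vertices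
  \<open>a, b\<close> next to \<open>u\<close> and \<open>p, q\<close> next to \<open>x\<close>.\<close>

definition hole_arms ::
  "'a set set \<Rightarrow> 'a set \<Rightarrow> 'a \<Rightarrow> 'a \<Rightarrow> 'a set \<Rightarrow> 'a \<Rightarrow> 'a \<Rightarrow> 'a set \<Rightarrow> 'a \<Rightarrow> 'a \<Rightarrow> bool" where
  "hole_arms E H u x A a p B b q \<longleftrightarrow>
     H = {u, x} \<union> A \<union> B \<and> u \<notin> A \<union> B \<and> x \<notin> A \<union> B \<and> u \<noteq> x \<and> \<not> adj E u x \<and>
     connected_in E A \<and> connected_in E B \<and> \<not> touch E A B \<and>
     a \<in> A \<and> p \<in> A \<and> b \<in> B \<and> q \<in> B \<and>
     (\<forall>s\<in>A. (adj E u s \<longleftrightarrow> s = a) \<and> (adj E x s \<longleftrightarrow> s = p)) \<and>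
     (\<forall>s\<in>B. (adj E u s \<longleftrightarrow> s = b) \<and> (adj E x s \<longleftrightarrow> s = q))"

lemma hole_armsD:
  assumes "hole_arms E H u x A a p B b q"
  shows "H = {u, x} \<union> A \<union> B" "u \<notin> A" "x \<notin> A" "u \<noteq> x" "\<not> adj E u x"
    "connected_in E A" "\<not> touch E A B" "a \<in> A" "p \<in> A" "adj E u a" "adj E x p"
    "s \<in> A \<Longrightarrow> adj E u s \<longleftrightarrow> s = a" "s \<in> A \<Longrightarrow> adj E x s \<longleftrightarrow> s = p"
  using assms unfolding hole_arms_def by simp_all

lemma hole_arms_swap:
  "hole_arms E H u x A a p B b q \<Longrightarrow> hole_arms E H u x B b q A a p"
  unfolding hole_arms_def by (auto simp: touch_commute)

lemma hole_arms_exist: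
  assumes H: "is_hole V E H" and "u \<in> H" "x \<in> H" "u \<noteq> x" "\<not> adj E u x"
  obtains A a p B b q where "hole_arms E H u x A a p B b q"
proof -
  obtain ps where ps: "H = insert u (set ps)" "u \<notin> set ps" "induced_path E ps" "length ps \<ge> 3"
    and u: "\<And>i. i < length ps \<Longrightarrow> adj E u (ps ! i) \<longleftrightarrow> i = 0 \<or> Suc i = length ps"
    using is_hole_pathE[OF H \<open>u \<in> H\<close>] by metis
  define n where "n = length ps"
  have dist: "distinct ps" and
    ad: "\<And>i j. i < n \<Longrightarrow> j < n \<Longrightarrow> adj E (ps ! i) (ps ! j) \<longleftrightarrow> j = Suc i \<or> i = Suc j"
    using ps(3) by (auto simp: induced_path_def n_def)
  have inj: "ps ! i = ps ! j \<longleftrightarrow> i = j" if "i < n" "j < n" for i j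
    using dist that by (simp add: nth_eq_iff_index_eq n_def)
  obtain k where k: "k < n" "ps ! k = x"
    using assms(3,4) ps(1) by (auto simp: in_set_conv_nth n_def)
  \<comment> \<open>Not being adjacent to \<open>u\<close>, the vertex \<open>x\<close> is neither
    end of the path, so both arcs are nonempty.\<close>
  have k0: "0 < k" "Suc k < n"
    using u[of k] k assms(5) by (auto simp: n_def)
  define A where "A = set (take k ps)"
  define B where "B = set (drop (Suc k) ps)"
  have A: "s \<in> A \<longleftrightarrow> (\<exists>i<k. s = ps ! i)" for s
    using k by (auto simp: A_def in_set_conv_nth n_def)
  have B: "s \<in> B \<longleftrightarrow> (\<exists>i. k < i \<and> i < n \<and> s = ps ! i)" for s
  proof -
    have "s \<in> B \<longleftrightarrow> (\<exists>i. i < n - Suc k \<and> s = ps ! (Suc k + i))"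
      using k by (auto simp: B_def in_set_conv_nth n_def)
    also have "\<dots> \<longleftrightarrow> (\<exists>i. k < i \<and> i < n \<and> s = ps ! i)"
    proof
      assume "\<exists>i. i < n - Suc k \<and> s = ps ! (Suc k + i)"
      then obtain i where "i < n - Suc k" "s = ps ! (Suc k + i)" by blast
      then show "\<exists>i. k < i \<and> i < n \<and> s = ps ! i"
        by (intro exI[of _ "Suc k + i"]) auto
    next
      assume "\<exists>i. k < i \<and> i < n \<and> s = ps ! i"
      then obtain i where "k < i" "i < n" "s = ps ! i" by blast
      then show "\<exists>i. i < n - Suc k \<and> s = ps ! (Suc k + i)"
        by (intro exI[of _ "i - Suc k"]) auto
    qed
    finally show ?thesis .
  qed
  have "ps = take k ps @ x # drop (Suc k) ps"
    using k id_take_nth_drop[of k ps] by (simp add: n_def)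
  then have setps: "set ps = insert x (A \<union> B)"
    unfolding A_def B_def by (metis Un_insert_right list.simps(15) set_append)
  have "connected_in E A"
    unfolding A_def by (rule induced_path_connected[OF induced_path_take[OF ps(3)]])
  moreover have "connected_in E B"
    unfolding B_def
    by (rule connected_in_set_path) (use ad in \<open>auto simp: n_def\<close>)
  moreover have "\<not> touch E A B"
    unfolding touch_def using k by (auto simp: A B inj ad)
  moreover have "ps ! 0 \<in> A" "ps ! (k - 1) \<in> A"
    unfolding A using k0 by (auto intro: exI[of _ "k - 1"])
  moreover have "ps ! Suc k \<in> B" "ps ! (n - 1) \<in> B"
    unfolding B using k0 by (auto intro: exI[of _ "n - 1"])
  moreover have "(adj E u s \<longleftrightarrow> s = ps ! 0) \<and> (adj E x s \<longleftrightarrow> s = ps ! (k - 1))" if "s \<in> A" for s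
  proof -
    obtain i where i: "i < k" "s = ps ! i" using \<open>s \<in> A\<close> A by blast
    have "adj E u s \<longleftrightarrow> i = 0" "adj E x s \<longleftrightarrow> i = k - 1"
      using u[of i] ad[of k i] i k k0 by (auto simp: n_def)
    then show ?thesis using i k k0 inj by auto
  qed
  moreover have "(adj E u s \<longleftrightarrow> s = ps ! (n - 1)) \<and> (adj E x s \<longleftrightarrow> s = ps ! Suc k)" if "s \<in> B" for s
  proof -
    obtain i where i: "k < i" "i < n" "s = ps ! i" using \<open>s \<in> B\<close> B by blast
    have "adj E u s \<longleftrightarrow> i = n - 1" "adj E x s \<longleftrightarrow> i = Suc k"
      using u[of i] ad[of k i] i k k0 by (auto simp: n_def)
    then show ?thesis using i k k0 inj by auto
  qed
  moreover have "x \<notin> A" "x \<notin> B"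
    using k inj by (auto simp: A B)
  moreover have "u \<notin> A" "u \<notin> B" using ps(2) setps by auto
  ultimately have "hole_arms E H u x A (ps ! 0) (ps ! (k - 1)) B (ps ! (n - 1)) (ps ! Suc k)"
    using assms(4,5) ps(1) setps unfolding hole_arms_def by auto
  then show ?thesis using that by blast
qed


text \<open>The form in which the NC property is exploited. The set \<open>W\<close> replaces
  \<open>u\<close> as a link between the two arms, so \<open>x\<close> closes an induced path from
  \<open>p\<close> to \<open>q\<close> in \<open>W \<union> A \<union> B\<close> to a hole without
  \<open>u\<close>. This hole shares the consecutive edges \<open>px\<close> and \<open>xq\<close>
  with \<open>H\<close>.\<close>

lemma NC_vertex_arms:
  assumes NC: "NC_vertex V E u" and H: "is_hole V E H"
    and arms: "hole_arms E H u x A a p B b q"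
    and W: "W \<subseteq> V" "connected_in E W" "u \<notin> W" "x \<notin> W" "\<And>w. w \<in> W \<Longrightarrow> \<not> adj E x w"
    and touch: "touch E W A" "touch E W B"
  shows False
proof -
  note A = hole_armsD[OF arms] and B = hole_armsD[OF hole_arms_swap[OF arms]]
  have HV: "H \<subseteq> V" using H by (simp add: is_hole_def)
  have pq: "p \<noteq> q" "\<not> adj E p q" using A(7,9) B(9) touchI by metis+
  let ?S = "W \<union> A \<union> B"
  have "connected_in E (W \<union> A)" by (rule connected_in_Un[OF W(2) A(6) touch(1)])
  then have con: "connected_in E ?S"
    by (rule connected_in_Un[OF _ B(6) touch_mono[OF touch(2)]]) auto
  have "adj E x s \<longleftrightarrow> s = p \<or> s = q" if "s \<in> ?S" for s
    using that A(11,13) B(11,13) W(5) by (metis Un_iff)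
  moreover have "x \<in> V" "?S \<subseteq> V" using A(1) HV W(1) by auto
  moreover have "x \<notin> ?S" using A(3) B(3) W(4) by simp
  moreover have "p \<in> ?S" "q \<in> ?S" using A(9) B(9) by simp_all
  ultimately obtain H' where H': "is_hole V E H'" "x \<in> H'" "p \<in> H'" "q \<in> H'"
      "H' \<subseteq> insert x ?S"
    using hole_at_vertex[of x V ?S E p q] pq con by metis
  have "u \<notin> H'" using H'(5) A(2,4) B(2) W(3) by blast
  moreover have "share_two_consecutive_edges E H H'"
    unfolding share_two_consecutive_edges_def
  proof (intro exI conjI)
    show "adj E p x" "adj E x q" using A(11) B(11) by (simp_all add: adj_commute)
    show "{p, x, q} \<subseteq> H" using A(1,9) B(9) by simp
  qed (use H' pq in simp_all)
  moreover have "u \<in> H" using A(1) by simp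
  ultimately show False
    using NC H H'(1) unfolding NC_vertex_def by blast
qed

lemma hole_minus_vertex_connected:
  assumes "is_hole V E H" "u \<in> H"
  shows "connected_in E (H - {u})"
proof -
  obtain ps where "H = insert u (set ps)" "u \<notin> set ps" "induced_path E ps"
    using is_hole_pathE[OF assms] by metis
  then show ?thesis using induced_path_connected by simp
qed

subsection \<open>Holes of a local chordalization\<close>

text \<open>In the application \<open>P\<close> is a supposed new hole through \<open>u\<close> with
  \<open>u\<close> removed, and \<open>x\<close>, \<open>y\<close> are the neighbours of
  \<open>u\<close> on it. From \<open>y\<close> one continues by a set \<open>T\<close> to a
  neighbour of \<open>u\<close>, choosing \<open>T\<close> without contact to \<open>x\<close>. Both
  arms of \<open>H\<close> must then touch \<open>T\<close>, since otherwise \<open>P\<close> would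
  be used by a hole through \<open>u\<close>; but a set touching both arms and not seen by
  \<open>x\<close> contradicts the NC property.\<close>

lemma no_path_outside_holes:
  assumes NC: "NC_vertex V E u"
    and P: "P \<subseteq> V" "connected_in E P" "u \<notin> P" "x \<in> P" "y \<in> P" "x \<noteq> y" "\<not> adj E x y"
    and interior: "\<And>z. z \<in> P \<Longrightarrow> z \<noteq> x \<Longrightarrow> z \<noteq> y \<Longrightarrow> \<not> adj E u z"
      "\<And>z H. z \<in> P \<Longrightarrow> z \<noteq> x \<Longrightarrow> z \<noteq> y \<Longrightarrow> is_hole V E H \<Longrightarrow> u \<in> H \<Longrightarrow> z \<notin> H"
    and H: "is_hole V E H" "u \<in> H" "x \<in> H" "\<not> adj E u x"
    and y: "adj E u y \<or> (\<exists>H. is_hole V E H \<and> u \<in> H \<and> y \<in> H)"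
  shows False
proof -
  have HV: "H \<subseteq> V" and uV: "u \<in> V" using H by (auto simp: is_hole_def)
  have ux: "u \<noteq> x" "u \<noteq> y" using P by auto
  obtain A a p B b q where arms: "hole_arms E H u x A a p B b q"
    using hole_arms_exist[OF H(1-3) ux(1) H(4)] by metis
  \<comment> \<open>Since \<open>u\<close> sees only one vertex of a good set, it sees just two
    vertices of the union of two such sets and \<open>P\<close>, as \<open>hole_at_vertex\<close>
    requires.\<close>
  define good where "good = (\<lambda>T t. T \<subseteq> V \<and> connected_in E T \<and> u \<notin> T \<and> t \<in> T \<and>
    (\<forall>s\<in>T. adj E u s \<longleftrightarrow> s = t))"
  \<comment> \<open>The two ways of continuing the path from \<open>y\<close> to a neighbour of \<open>u\<close> along a hole;
      \<open>x\<close> cannot see both of them.\<close>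
  obtain T1 t1 T2 t2 where T: "good T1 t1" "good T2 t2" "y \<in> T1" "y \<in> T2"
    and not_both: "\<not> (touch E {x} T1 \<and> touch E {x} T2)"
  proof (cases "adj E u y")
    case True
    then show ?thesis
      using that[of "{y}" y "{y}" y] P ux by (auto simp: good_def touch_def)
  next
    case False
    then obtain H' where H': "is_hole V E H'" "u \<in> H'" "y \<in> H'" using y by blast
    obtain A' a' p' B' b' q' where arms': "hole_arms E H' u y A' a' p' B' b' q'"
      using hole_arms_exist[OF H' ux(2) False] by metis
    have "H' \<subseteq> V" using H' by (simp add: is_hole_def)
    have arm_good: "good (insert y A') a'" if "hole_arms E H' u y A' a' p' B' b' q'"
      for A' a' p' B' b' q'
    proof -
      note ar = hole_armsD[OF that]
      have "touch E {y} A'" using ar(9,11) by (intro touchI) auto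
      from connected_in_Un[OF connected_in_singleton ar(6) this]
      have "connected_in E (insert y A')" by simp
      moreover have "insert y A' \<subseteq> V" using ar(1) \<open>H' \<subseteq> V\<close> by auto
      moreover have "adj E u s \<longleftrightarrow> s = a'" if "s \<in> insert y A'" for s
        using that ar(5,10,12) by (metis insertE)
      ultimately show ?thesis using ar(2,4,8) unfolding good_def by simp
    qed
    have "good (insert y A') a'" "good (insert y B') b'"
      using arm_good[OF arms'] arm_good[OF hole_arms_swap[OF arms']] by auto
    moreover have "\<not> (touch E {x} (insert y A') \<and> touch E {x} (insert y B'))"
    proof
      assume "touch E {x} (insert y A') \<and> touch E {x} (insert y B')"
      then have "touch E {x} A'" "touch E {x} B'" using P by (auto simp: touch_def)
      then show False
        using NC_vertex_arms[OF NC H'(1) arms', of "{x}"] P ux by (auto simp: adj_commute)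
    qed
    ultimately show ?thesis using that by blast
  qed
  have arm_touch: "touch E T A" if ar: "hole_arms E H u x A a p B b q"
    and T: "good T t" "y \<in> T" "\<not> touch E {x} T" for T t A a p B b q
  proof -
    note ar = hole_armsD[OF ar]
    have A: "good (insert x A) a"
    proof -
      have "touch E {x} A" using ar(9,11) by (intro touchI) auto
      from connected_in_Un[OF connected_in_singleton ar(6) this]
      have "connected_in E (insert x A)" by simp
      moreover have "insert x A \<subseteq> V" using ar(1) HV by auto
      moreover have "adj E u s \<longleftrightarrow> s = a" if "s \<in> insert x A" for s
        using that ar(5,10,12) by (metis insertE)
      ultimately show ?thesis using ar(2,4,8) unfolding good_def by simp
    qed
    have "touch E (insert x A) T"
    proof (cases "a = t \<or> adj E a t")
      case True
      then show ?thesis using ar(8) T(1) touchI[of a "insert x A" t T E] by (simp add: good_def)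
    next
      case False
      let ?S = "insert x A \<union> P \<union> T"
      have "touch E (insert x A) P" using P(4) by (intro touchI[of x]) auto
      then have "connected_in E (insert x A \<union> P)"
        using A P(2) by (intro connected_in_Un) (simp_all add: good_def)
      moreover have "touch E (insert x A \<union> P) T" using P(5) T(2) by (intro touchI[of y]) auto
      moreover have "connected_in E T" using T(1) by (simp add: good_def)
      ultimately have "connected_in E ?S" by (metis connected_in_Un)
      moreover have "adj E u s \<longleftrightarrow> s = a \<or> s = t" if "s \<in> ?S" for s
        using that A T(1,2) interior(1) unfolding good_def by blast
      moreover have "?S \<subseteq> V" "u \<notin> ?S" "a \<in> ?S" "t \<in> ?S"
        using A T(1) P(1,3) unfolding good_def by auto
      ultimately obtain Z where Z: "is_hole V E Z" "u \<in> Z" "a \<in> Z" "t \<in> Z" "Z \<subseteq> insert u ?S"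
        using hole_at_vertex[of u V ?S E a t] False uV by metis
      \<comment> \<open>The hole \<open>Z\<close> contains \<open>u\<close>, so by assumption it
        avoids the interior of \<open>P\<close>. Without \<open>u\<close> it still connects
        \<open>a\<close> to \<open>t\<close>, which forces contact between the arm with
        \<open>x\<close> and \<open>T\<close>.\<close>
      have "Z - {u} \<subseteq> insert x A \<union> T"
        using Z(1,2,5) interior(2)[OF _ _ _ Z(1,2)] T(2) by blast
      moreover have "a \<noteq> u" "t \<noteq> u" using \<open>u \<notin> ?S\<close> \<open>a \<in> ?S\<close> \<open>t \<in> ?S\<close> by auto
      ultimately show ?thesis
        using Z(3,4) ar(8) T(1) unfolding good_def
        by (intro connected_in_touch[OF hole_minus_vertex_connected[OF Z(1,2)], of _ _ a t]) auto
    qed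
    then have "touch E A T" using T(3) by (auto simp: touch_def)
    then show ?thesis by (simp add: touch_commute)
  qed
  have "False" if T: "good T t" "y \<in> T" "\<not> touch E {x} T" for T t
  proof (rule NC_vertex_arms[OF NC H(1) arms, of T])
    show "touch E T A" "touch E T B"
      using arm_touch[OF arms T] arm_touch[OF hole_arms_swap[OF arms] T] by auto
  qed (use T in \<open>auto simp: good_def touch_def\<close>)
  then show False using T not_both by blast
qed

lemma adj_local_chordalize:
  "adj (local_chordalize V E u) x y \<longleftrightarrow> adj E x y \<or>
     x \<noteq> y \<and> (x = u \<or> y = u) \<and> (\<exists>H. is_hole V E H \<and> u \<in> H \<and> x \<in> H \<and> y \<in> H)"
  unfolding adj_def local_chordalize_def by (auto simp: doubleton_eq_iff)

lemma is_hole_cong: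
  assumes "\<And>x y. x \<in> H \<Longrightarrow> y \<in> H \<Longrightarrow> adj E x y \<longleftrightarrow> adj F x y"
  shows "is_hole V E H \<longleftrightarrow> is_hole V F H"
proof -
  have "adj E (vs ! i) (vs ! j) \<longleftrightarrow> adj F (vs ! i) (vs ! j)"
    if "set vs = H" "i < length vs" "j < length vs" for vs i j
    using assms[of "vs ! i" "vs ! j"] that by auto
  then show ?thesis unfolding is_hole_def by (simp cong: conj_cong)
qed

text \<open>Away from \<open>u\<close> no edge changes. A new hole through \<open>u\<close> is
  \<open>u\<close> over a path whose interior avoids the old neighbours of \<open>u\<close> and all
  old holes through \<open>u\<close>, as these vertices are now joined to \<open>u\<close>. If both
  path ends are old neighbours of \<open>u\<close>, the hole is itself old, which is absurd;
  otherwise \<open>no_path_outside_holes\<close> applies, starting from an end that is not an old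
  neighbour.\<close>

lemma is_hole_local_chordalize:
  assumes NC: "NC_vertex V E u"
  shows "is_hole V (local_chordalize V E u) H \<longleftrightarrow> is_hole V E H \<and> u \<notin> H"
proof -
  let ?F = "local_chordalize V E u"
  have "u \<notin> Z" if Z: "is_hole V ?F Z" for Z
  proof
    assume "u \<in> Z"
    then obtain ps where ps: "Z = insert u (set ps)" "u \<notin> set ps" "induced_path ?F ps"
        "length ps \<ge> 3"
      and u: "\<And>i. i < length ps \<Longrightarrow> adj ?F u (ps ! i) \<longleftrightarrow> i = 0 \<or> Suc i = length ps"
      using is_hole_pathE[OF Z] by metis
    have nonu: "ps ! i \<noteq> u" if "i < length ps" for i
      using ps(2) nth_mem[OF that] by metis
    have ipE: "induced_path E ps"
      using ps(3) nonu unfolding induced_path_def adj_local_chordalize by blast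
    define x y where "x = ps ! 0" and "y = ps ! (length ps - 1)"
    have l: "0 < length ps" "1 < length ps" "length ps - 1 < length ps" using ps(4) by auto
    have nth_eq: "ps ! i = ps ! j \<longleftrightarrow> i = j" if "i < length ps" "j < length ps" for i j
      using ipE that by (simp add: induced_path_def nth_eq_iff_index_eq)
    have "x \<noteq> y" unfolding x_def y_def nth_eq[OF l(1,3)] using ps(4) by simp
    moreover have "\<not> adj E x y"
      using ipE l ps(4) unfolding x_def y_def induced_path_def by fastforce
    ultimately have xy: "x \<in> set ps" "y \<in> set ps" "x \<noteq> y" "\<not> adj E x y"
      using l by (auto simp: x_def y_def)
    have int: "\<not> adj ?F u z" if "z \<in> set ps" "z \<noteq> x" "z \<noteq> y" for z
    proof -
      obtain i where "i < length ps" "z = ps ! i" using \<open>z \<in> set ps\<close> by (auto simp: in_set_conv_nth)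
      then show ?thesis
        using u[of i] that unfolding x_def y_def by (metis diff_Suc_1)
    qed
    have F: "adj ?F u x" "adj ?F u y" using u[OF l(1)] u[OF l(3)] l by (auto simp: x_def y_def)
    have PV: "set ps \<subseteq> V" using Z ps(1) by (simp add: is_hole_def)
    have int1: "\<not> adj E u z" if "z \<in> set ps" "z \<noteq> x" "z \<noteq> y" for z
      using int[OF that] by (simp add: adj_local_chordalize)
    have int2: "z \<notin> H" if "z \<in> set ps" "z \<noteq> x" "z \<noteq> y" "is_hole V E H" "u \<in> H" for z H
      using int[OF that(1-3)] that ps(2) by (auto simp: adj_local_chordalize)
    note con = induced_path_connected[OF ipE]
    consider "adj E u x" "adj E u y" | "\<not> adj E u x" | "\<not> adj E u y" by blast
    then show False
    proof cases
      case 1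
      have nbr: "adj E u z" if "z \<in> Z" "adj ?F u z" for z
        using that int 1 ps(1) by (cases "z = u") auto
      have "adj E v w \<longleftrightarrow> adj ?F v w" if "v \<in> Z" "w \<in> Z" for v w
      proof (cases "v = u \<or> w = u")
        case True
        then show ?thesis
          using nbr that adj_local_chordalize[of V E u] by (metis adj_commute)
      next
        case False
        then show ?thesis by (simp add: adj_local_chordalize)
      qed
      then have "is_hole V E Z" using Z is_hole_cong[of Z E ?F V] by blast
      \<comment> \<open>By \<open>length ps \<ge> 3\<close> this vertex lies strictly between the
        ends. It is on an old hole through \<open>u\<close>, contrary to
        \<open>int2\<close>.\<close>
      moreover have "ps ! 1 \<in> set ps" "ps ! 1 \<noteq> x" "ps ! 1 \<noteq> y"
        unfolding x_def y_def nth_eq[OF l(2,1)] nth_eq[OF l(2,3)] using l ps(4) by auto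
      ultimately show False using int2 ps(1) by blast
    next
      case 2
      then obtain H where H: "is_hole V E H" "u \<in> H" "x \<in> H"
        using F(1) by (auto simp: adj_local_chordalize)
      have "adj E u y \<or> (\<exists>H. is_hole V E H \<and> u \<in> H \<and> y \<in> H)"
        using F(2) by (auto simp: adj_local_chordalize)
      then show False
        using no_path_outside_holes[OF NC PV con ps(2) xy int1 int2 H 2] by blast
    next
      case 3
      then obtain H where H: "is_hole V E H" "u \<in> H" "y \<in> H"
        using F(2) by (auto simp: adj_local_chordalize)
      have "adj E u x \<or> (\<exists>H. is_hole V E H \<and> u \<in> H \<and> x \<in> H)"
        using F(1) by (auto simp: adj_local_chordalize)
      moreover have "y \<noteq> x" "\<not> adj E y x" using xy by (auto simp: adj_commute)
      ultimately show False
        using no_path_outside_holes[OF NC PV con ps(2) xy(2,1) _ _ int1 int2 H 3] by blast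
    qed
  qed
  moreover have "is_hole V ?F H \<longleftrightarrow> is_hole V E H" if "u \<notin> H"
    using that by (intro is_hole_cong) (auto simp: adj_local_chordalize)
  ultimately show ?thesis by blast
qed

section \<open>Iterating the local chordalization along the cover\<close>

lemma hole_vertex_unique:
  assumes "simple_graph V E" "NC_set V E C" "is_hole V E H" "u \<in> H" "v \<in> H" "u \<in> C" "v \<in> C"
  shows "u = v"
proof -
  \<comment> \<open>Finiteness matters: an infinite set has \<open>card\<close> equal to 0, and the
    bound would say nothing.\<close>
  have "finite H"
    using assms(1,3) by (auto simp: simple_graph_def is_hole_def intro: finite_subset)
  moreover have "card (H \<inter> C) \<le> 1" using assms by (simp add: NC_set_def)
  ultimately show ?thesis using assms card_le_Suc0_iff_eq[of "H \<inter> C"] by auto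
qed

lemma simple_graph_local_chordalize:
  assumes "simple_graph V E"
  shows "simple_graph V (local_chordalize V E u)"
proof -
  have "H \<subseteq> V" if "is_hole V E H" for H using that by (simp add: is_hole_def)
  then show ?thesis
    using assms unfolding simple_graph_def local_chordalize_def by blast
qed

text \<open>The holes that remain are old holes avoiding \<open>u\<close>, and on vertex sets
  avoiding \<open>u\<close> the edges are unchanged, so any violation would already be one in the
  old graph.\<close>

lemma NC_set_local_chordalize:
  assumes "simple_graph V E" "NC_set V E (insert u C)"
  shows "NC_set V (local_chordalize V E u) C"
proof -
  let ?F = "local_chordalize V E u"
  have hole: "is_hole V ?F H \<longleftrightarrow> is_hole V E H \<and> u \<notin> H" for H
    using assms(2) by (intro is_hole_local_chordalize) (simp add: NC_set_def)
  have "NC_vertex V ?F v" if "v \<in> C" for v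
  proof -
    have "share_two_consecutive_edges ?F H H' \<Longrightarrow> share_two_consecutive_edges E H H'"
      if "u \<notin> H" for H H'
      using that unfolding share_two_consecutive_edges_def adj_local_chordalize by blast
    moreover have "NC_vertex V E v" using assms(2) that by (simp add: NC_set_def)
    ultimately show ?thesis unfolding NC_vertex_def hole by blast
  qed
  moreover have "card (H \<inter> C) \<le> 1" if "is_hole V E H" for H
  proof -
    have "finite H"
      using assms(1) that by (auto simp: simple_graph_def is_hole_def intro: finite_subset)
    then show ?thesis
      using hole_vertex_unique[OF assms that] by (simp add: card_le_Suc0_iff_eq)
  qed
  ultimately show ?thesis by (simp add: NC_set_def hole)
qed

text \<open>Holes destroyed by an earlier \<open>u\<close> contain no later cover vertex, since a
  hole meets the cover at most once. Hence each step adds what the original holes dictate, and the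
  result depends on \<open>set us\<close> only.\<close>

lemma adj_chordalize_seq:
  assumes "simple_graph V E" "NC_set V E (set us)" "distinct us"
  shows "adj (chordalize_seq V E us) x y \<longleftrightarrow> adj E x y \<or>
     x \<noteq> y \<and> (x \<in> set us \<or> y \<in> set us) \<and> (\<exists>H. is_hole V E H \<and> x \<in> H \<and> y \<in> H)"
  using assms
proof (induction us arbitrary: E)
  case Nil
  then show ?case by (simp add: chordalize_seq_def)
next
  case (Cons u us)
  let ?F = "local_chordalize V E u"
  have hole: "is_hole V ?F H \<longleftrightarrow> is_hole V E H \<and> u \<notin> H" for H
    using Cons.prems(2) by (intro is_hole_local_chordalize) (simp add: NC_set_def)
  have "u \<notin> H" if "is_hole V E H" "v \<in> H" "v \<in> set us" for H v
    using hole_vertex_unique[OF Cons.prems(1,2) that(1), of u v] that Cons.prems(3) by auto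
  moreover have "adj (chordalize_seq V ?F us) x y \<longleftrightarrow> adj ?F x y \<or>
     x \<noteq> y \<and> (x \<in> set us \<or> y \<in> set us) \<and> (\<exists>H. is_hole V ?F H \<and> x \<in> H \<and> y \<in> H)"
    using Cons.prems simple_graph_local_chordalize NC_set_local_chordalize
    by (intro Cons.IH) auto
  moreover have "chordalize_seq V E (u # us) = chordalize_seq V ?F us"
    by (simp add: chordalize_seq_def)
  ultimately show ?case
    unfolding hole adj_local_chordalize by auto
qed

subsection \<open>Cliques of the chordalization\<close>

lemma has_clique_minorI:
  assumes "finite K"
    and "\<And>k. k \<in> K \<Longrightarrow> B k \<noteq> {} \<and> B k \<subseteq> V \<and> connected_in E (B k)"
    and "\<And>k l. k \<in> K \<Longrightarrow> l \<in> K \<Longrightarrow> k \<noteq> l \<Longrightarrow>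
           B k \<inter> B l = {} \<and> (\<exists>x\<in>B k. \<exists>y\<in>B l. adj E x y)"
  shows "has_clique_minor V E (card K)"
proof -
  obtain f where f: "bij_betw f {0..<card K} K"
    using ex_bij_betw_nat_finite[OF assms(1)] by blast
  have "f i \<in> K" if "i < card K" for i
    using f that by (auto simp: bij_betw_def)
  moreover have "f i \<noteq> f j" if "i < card K" "j < card K" "i \<noteq> j" for i j
    using f that by (auto simp: bij_betw_def inj_on_def)
  ultimately show ?thesis
    unfolding has_clique_minor_def using assms(2,3)
    by (intro exI[of _ "\<lambda>i. B (f i)"]) auto
qed

text \<open>If \<open>v\<close> touched both arms, \<open>{v}\<close> would be a link between them
  of the kind excluded by \<open>NC_vertex_arms\<close>.\<close>

lemma exists_arm_avoiding_neighbours: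
  assumes NC: "NC_vertex V E u" and H: "is_hole V E H" "u \<in> H" "w \<in> H" "u \<noteq> w" "\<not> adj E u w"
    and v: "v \<in> V" "v \<noteq> u" "v \<noteq> w" "\<not> adj E v w"
  obtains A a p B b q where "hole_arms E H u w A a p B b q" "\<not> touch E {v} A"
proof -
  obtain A a p B b q where arms: "hole_arms E H u w A a p B b q"
    using hole_arms_exist[OF H] by metis
  have "\<not> (touch E {v} A \<and> touch E {v} B)"
    using NC_vertex_arms[OF NC H(1) arms, of "{v}"] v by (auto simp: adj_commute)
  then show ?thesis using that arms hole_arms_swap[OF arms] by blast
qed

text \<open>Take an arm from \<open>u\<close> to \<open>w\<close> untouched by \<open>v\<close> and
  an arm from \<open>v\<close> to \<open>w\<close> untouched by \<open>u\<close>. Joined at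
  \<open>w\<close> and extended by \<open>v\<close>, they form a connected set in which
  \<open>u\<close> sees only \<open>v\<close> and the first vertex \<open>a\<close> of its own arm.
  As \<open>v\<close> and \<open>a\<close> are nonadjacent, a hole through both \<open>u\<close> and
  \<open>v\<close> arises, although a hole meets \<open>C\<close> at most once.\<close>

lemma adjacent_cover_vertices_common_nonneighbour:
  assumes G: "simple_graph V E" and NC: "NC_set V E C"
    and uv: "u \<in> C" "v \<in> C" "adj E u v"
    and H: "is_hole V E H" "u \<in> H" "w \<in> H" "u \<noteq> w" "\<not> adj E u w"
    and H': "is_hole V E H'" "v \<in> H'" "w \<in> H'" "v \<noteq> w" "\<not> adj E v w"
  shows False
proof -
  have V: "H \<subseteq> V" "H' \<subseteq> V" using H H' by (auto simp: is_hole_def)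
  have NCu: "NC_vertex V E u" and NCv: "NC_vertex V E v" using NC uv by (auto simp: NC_set_def)
  have ne: "u \<noteq> v" using uv(3) by (simp add: adj_def)
  obtain A a p B b q where arms: "hole_arms E H u w A a p B b q" and A: "\<not> touch E {v} A"
    using exists_arm_avoiding_neighbours[OF NCu H, of v] H' V ne by blast
  obtain A' a' p' B' b' q' where arms': "hole_arms E H' v w A' a' p' B' b' q'"
    and A': "\<not> touch E {u} A'"
    using exists_arm_avoiding_neighbours[OF NCv H', of u] H V ne by blast
  note ar = hole_armsD[OF arms] and ar' = hole_armsD[OF arms']
  let ?S = "A \<union> {w} \<union> (A' \<union> {v})"
  have "touch E A {w}" "touch E A' {v}"
    using ar(9,11) ar'(8,10) by (auto intro: touchI simp: adj_commute)
  then have "connected_in E (A \<union> {w})" "connected_in E (A' \<union> {v})"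
    using connected_in_Un ar(6) ar'(6) connected_in_singleton by metis+
  moreover have "touch E (A \<union> {w}) (A' \<union> {v})"
    using ar'(9,11) by (intro touchI[of w _ p']) auto
  ultimately have con: "connected_in E ?S" by (rule connected_in_Un)
  have uA': "u \<notin> A'" "\<not> adj E u s" if "s \<in> A'" for s
    using A' touchI[of u "{u}" _ A'] that by blast+
  have vA: "v \<noteq> a" "\<not> adj E v a"
    using A touchI[of v "{v}" a A] ar(8) by blast+
  have "adj E u s \<longleftrightarrow> s = v \<or> s = a" if "s \<in> ?S" for s
    using that ar(5,10,12) uA'(2) uv(3) by (metis Un_iff singletonD)
  moreover have "u \<in> V" "?S \<subseteq> V" using ar(1) ar'(1) V by auto
  moreover have "u \<notin> ?S" using ar(2) uA'(1) H(4) ne by blast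
  moreover have "a \<in> ?S" "v \<in> ?S" using ar(8) by simp_all
  ultimately obtain Z where "is_hole V E Z" "u \<in> Z" "v \<in> Z"
    using hole_at_vertex[of u V ?S E v a] con vA by metis
  then show False using hole_vertex_unique[OF G NC] uv ne by blast
qed

lemma is_hole_square:
  assumes "{x, y, z, t} \<subseteq> V" "x \<noteq> z" "y \<noteq> t"
    "adj E x y" "adj E y z" "adj E z t" "adj E t x" "\<not> adj E x z" "\<not> adj E y t"
  shows "is_hole V E {x, y, z, t}"
proof -
  have "is_hole V E (insert x (set [y, z, t]))"
  proof (rule is_hole_pathI)
    show "induced_path E [y, z, t]"
      using assms unfolding induced_path_def
      by (auto simp: less_Suc_eq adj_def insert_commute)
    show "adj E x ([y, z, t] ! i) \<longleftrightarrow> i = 0 \<or> Suc i = length [y, z, t]"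
      if "i < length [y, z, t]" for i
      using that assms by (auto simp: less_Suc_eq adj_commute[of E x t])
  qed (use assms in \<open>auto simp: adj_def\<close>)
  then show ?thesis by simp
qed

theorem theorem2p8:
  fixes V :: "'a set" and E :: "'a set set" and C :: "'a set" and us :: "'a list" and K :: "'a set"
  assumes "simple_graph V E"
    and "hole_cover V E C"
    and "NC_set V E C"
    and "distinct us" and "set us = C"
    and "K \<subseteq> V"
    and "is_clique (chordalize_seq V E us) K"
  shows "has_clique_minor V E (card K)"
proof -
  note G = assms(1) and NC = assms(3)
  have "finite K" using G assms(6) by (auto simp: simple_graph_def intro: finite_subset)
  have K: "adj E x y \<or> (x \<in> C \<or> y \<in> C) \<and> (\<exists>H. is_hole V E H \<and> x \<in> H \<and> y \<in> H)"
    if "x \<in> K" "y \<in> K" "x \<noteq> y" for x y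
    using assms(7) that adj_chordalize_seq[OF G _ assms(4), of x y] NC assms(5)
    by (auto simp: is_clique_def)
  define miss where "miss = (\<lambda>u w. u \<in> K \<and> w \<in> K \<and> u \<noteq> w \<and> u \<in> C \<and> \<not> adj E u w)"
  have miss_hole: "\<exists>H. is_hole V E H \<and> u \<in> H \<and> w \<in> H" if "miss u w" for u w
    using K[of u w] that by (auto simp: miss_def)
  have CK: "adj E u v" if "u \<in> K \<inter> C" "v \<in> K \<inter> C" "u \<noteq> v" for u v
    using K[of u v] that hole_vertex_unique[OF G NC] by blast
  have miss_C: "w \<notin> C" if "miss u w" for u w
    using CK[of u w] that by (auto simp: miss_def)
  have miss_unique: "u = v" if "miss u w" "miss v t" for u v w t
  proof (rule ccontr)
    assume "u \<noteq> v"
    then have uv: "u \<in> C" "v \<in> C" "adj E u v" using CK that by (auto simp: miss_def)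
    have common: False if "miss u s" "miss v s" for s
      using adjacent_cover_vertices_common_nonneighbour[OF G NC uv]
        miss_hole[OF that(1)] miss_hole[OF that(2)] that unfolding miss_def by blast
    have "v \<noteq> w" "u \<noteq> t" using miss_C that uv by auto
    then have vw: "adj E v w" "adj E u t"
      using common that unfolding miss_def by blast+
    have "w \<noteq> t" using common that by blast
    then have "adj E w t" using K[of w t] that miss_C unfolding miss_def by blast
    \<comment> \<open>The diagonals of this 4-cycle are the missing edges \<open>uw\<close> and
      \<open>vt\<close>. The side \<open>wt\<close> is an edge of the original graph because neither
      end lies in \<open>C\<close>.\<close>
    then have "is_hole V E {u, v, w, t}"
      using that vw uv assms(6) unfolding miss_def
      by (intro is_hole_square) (auto simp: adj_commute)
    then show False using hole_vertex_unique[OF G NC] uv \<open>u \<noteq> v\<close> by blast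
  qed
  show ?thesis
  proof (cases "\<exists>u w. miss u w")
    case False
    then have "adj E x y" if "x \<in> K" "y \<in> K" "x \<noteq> y" for x y
      using K[of x y] that unfolding miss_def by (metis adj_commute)
    then show ?thesis
      using assms(6) \<open>finite K\<close> by (intro has_clique_minorI[of K "\<lambda>k. {k}"]) auto
  next
    case True
    then obtain u w0 where u: "miss u w0" by blast
    have uK: "u \<in> K" "u \<in> C" using u by (auto simp: miss_def)
    have rest: "adj E x y" if "x \<in> K" "y \<in> K" "x \<noteq> y" "x \<noteq> u" "y \<noteq> u" for x y
      using K[of x y] that miss_unique[OF u] unfolding miss_def by (metis adj_commute)
    \<comment> \<open>Instead of choosing one arm per missing edge, all connected sets off
      \<open>K\<close> that are attached to \<open>u\<close> are taken together; overlaps do no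
      harm, because everything joins the one branch set \<open>U\<close>.\<close>
    define arms where
      "arms = {A. A \<subseteq> V \<and> connected_in E A \<and> A \<inter> K = {} \<and> (\<exists>a\<in>A. adj E u a)}"
    define U where "U = insert u (\<Union>arms)"
    have reach: "\<exists>s\<in>U. adj E s w" if w: "w \<in> K" "w \<noteq> u" for w
    proof (cases "adj E u w")
      case True
      then show ?thesis by (auto simp: U_def)
    next
      case False
      then have "miss u w" using w uK by (auto simp: miss_def)
      then obtain H where H: "is_hole V E H" "u \<in> H" "w \<in> H" using miss_hole by blast
      obtain A a p B b q where ha: "hole_arms E H u w A a p B b q"
        using hole_arms_exist[OF H _ False] w by metis
      note A = hole_armsD[OF ha] and B = hole_armsD[OF hole_arms_swap[OF ha]]
      have "H \<subseteq> V" using H by (simp add: is_hole_def)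
      \<comment> \<open>The two arms are not joined by an edge, so the clique meets at most one of them.\<close>
      have "A \<inter> K = {} \<or> B \<inter> K = {}"
      proof (rule ccontr)
        assume "\<not> (A \<inter> K = {} \<or> B \<inter> K = {})"
        then obtain s t where st: "s \<in> A" "s \<in> K" "t \<in> B" "t \<in> K" by blast
        then have "s \<noteq> t" "\<not> adj E s t" "s \<noteq> u" "t \<noteq> u"
          using A(2,7) B(2) touchI[of s A t B E] by auto
        then show False using rest st by blast
      qed
      then have "A \<in> arms \<or> B \<in> arms"
        using A(1,6,8,10) B(6,8,10) \<open>H \<subseteq> V\<close> unfolding arms_def by auto
      moreover have "p \<in> A" "adj E p w" "q \<in> B" "adj E q w"
        using A(9,11) B(9,11) by (simp_all add: adj_commute)
      ultimately show ?thesis unfolding U_def by blast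
    qed
    have conU: "connected_in E U"
    proof -
      \<comment> \<open>Each arm together with \<open>u\<close> is connected, so \<open>u\<close>
        serves as a hub through which any two vertices of \<open>U\<close> are linked.\<close>
      have "(u, x) \<in> {(a, b). a \<in> U \<and> b \<in> U \<and> adj E a b}\<^sup>* \<and>
          (x, u) \<in> {(a, b). a \<in> U \<and> b \<in> U \<and> adj E a b}\<^sup>*" if x: "x \<in> U" for x
      proof (cases "x = u")
        case False
        then obtain A where A: "A \<in> arms" "x \<in> A" using x by (auto simp: U_def)
        then have "connected_in E ({u} \<union> A)"
          unfolding arms_def by (intro connected_in_Un) (auto simp: touch_def)
        moreover have "{u} \<union> A \<subseteq> U" using A by (auto simp: U_def)
        then have "{(a, b). a \<in> {u} \<union> A \<and> b \<in> {u} \<union> A \<and> adj E a b}\<^sup>* \<subseteq>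
            {(a, b). a \<in> U \<and> b \<in> U \<and> adj E a b}\<^sup>*"
          by (intro rtrancl_mono) blast
        ultimately show ?thesis using A(2) unfolding connected_in_def by blast
      qed simp
      then show ?thesis unfolding connected_in_def by (meson rtrancl_trans)
    qed
    have UK: "U \<inter> K = {u}" using uK by (auto simp: U_def arms_def)
    have UV: "U \<subseteq> V" using uK assms(6) by (auto simp: U_def arms_def)
    define B where "B = (\<lambda>k. if k = u then U else {k})"
    show ?thesis
    proof (rule has_clique_minorI[OF \<open>finite K\<close>, of B])
      show "B k \<noteq> {} \<and> B k \<subseteq> V \<and> connected_in E (B k)" if "k \<in> K" for k
        using that assms(6) conU UV by (auto simp: B_def U_def)
      show "B k \<inter> B l = {} \<and> (\<exists>x\<in>B k. \<exists>y\<in>B l. adj E x y)"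
        if kl: "k \<in> K" "l \<in> K" "k \<noteq> l" for k l
      proof (cases "k = u \<or> l = u")
        case True
        then show ?thesis
          using kl UK reach[of k] reach[of l] by (auto simp: B_def adj_commute[of E k])
      next
        case False
        then show ?thesis using kl rest by (auto simp: B_def)
      qed
    qed
  qed
qed

end
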